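(* Let $n\ge 1$ and let $\sigma\in\mathfrak{S}_n^B$ be a signed permutation of length $n$. Then $$\mathrm{al}(\sigma)+\mathrm{cr}(\sigma)=\Bigl(n-\tfrac12\,\mathrm{fwex}(\sigma)\Bigr)\bigl(\mathrm{wex}(\sigma)-1+\mathrm{neg}(\sigma)\bigr)+\tfrac12\,\mathrm{neg}(\sigma)\,\mathrm{wex}(\sigma).$$
   Context: $[n]=\{1,\dots,n\}$ and $[\pm n]=\{\pm1,\dots,\pm n\}$. A signed permutation of length $n$ is a permutation $\sigma$ of $[\pm n]$ with $\sigma(-i)=-\sigma(i)$ for all $i$; $\mathfrak{S}_n^B$ is the group of all of them. $\mathrm{wex}(\sigma)$ is the number of weak excedances, i.e. of $i\in[n]$ with $\sigma(i)\ge i$. $\mathrm{neg}(\sigma)$ is the number of $i\in[n]$ with $\sigma(i)<0$. $\mathrm{fwex}(\sigma)=2\,\mathrm{wex}(\sigma)+\mathrm{neg}(\sigma)$. Alignments. $A_{nest}(\sigma)$ is the set of $(i,j)\in[n]\times[n]$ satisfying at least one of: $-i<-j<-\sigma(j)<-\sigma(i)$; $\ -i<j\le\sigma(j)<-\sigma(i)$; $\ i<j\le\sigma(j)<\sigma(i)$. $A_{EN}(\sigma)$ is the set of $(i,j)\in[n]\times[n]$ satisfying at least one of: $-i<0<-\sigma(i)<\sigma(j)<j$; $\ i\le\sigma(i)<\sigma(j)<j$. $A_{NE}(\sigma)$ is the set of $(i,j)\in[n]\times[n]$ with $\sigma(i)<i<j\le\sigma(j)$. $\mathrm{al}(\sigma)=|A_{nest}(\sigma)|+|A_{EN}(\sigma)|+|A_{NE}(\sigma)|$.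 Crossings. $C(\sigma)$ is the set of $(i,j)\in[n]\times[n]$ satisfying at least one of: $i<j\le\sigma(i)<\sigma(j)$; $\ -i<-j<-\sigma(i)<-\sigma(j)$; $\ -i<j\le-\sigma(i)<\sigma(j)$. $\mathrm{cr}(\sigma)=|C(\sigma)|$. *)

theory Defs
  imports Complex_Main "HOL-Combinatorics.Permutations"
begin

definition pos_range :: "nat \<Rightarrow> int set"  (\<open>'[_']\<^sub>+\<close>) where
  "[n]\<^sub>+ = {1..int n}"

definition pm_range :: "nat \<Rightarrow> int set"  (\<open>'[\<plusminus>_']\<close>) where
  "[\<plusminus>n] = [n]\<^sub>+ \<union> uminus ` [n]\<^sub>+"

text \<open>Following the convention of \<^const>\<open>permutes\<close>, a signed permutation is represented by a
  function on all integers that is the identity outside \<open>[\<plusminus>n]\<close>.\<close>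

definition signed_perms :: "nat \<Rightarrow> (int \<Rightarrow> int) set" where
  "signed_perms n = {\<sigma>. \<sigma> permutes [\<plusminus>n] \<and> (\<forall>i\<in>[\<plusminus>n]. \<sigma> (- i) = - \<sigma> i)}"

definition wex :: "nat \<Rightarrow> (int \<Rightarrow> int) \<Rightarrow> nat" where
  "wex n \<sigma> = card {i \<in> [n]\<^sub>+. \<sigma> i \<ge> i}"

definition neg :: "nat \<Rightarrow> (int \<Rightarrow> int) \<Rightarrow> nat" where
  "neg n \<sigma> = card {i \<in> [n]\<^sub>+. \<sigma> i < 0}"

definition fwex :: "nat \<Rightarrow> (int \<Rightarrow> int) \<Rightarrow> nat" where
  "fwex n \<sigma> = 2 * wex n \<sigma> + neg n \<sigma>"

definition A_nest :: "nat \<Rightarrow> (int \<Rightarrow> int) \<Rightarrow> (int \<times> int) set" where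
  "A_nest n \<sigma> = {(i, j) \<in> [n]\<^sub>+ \<times> [n]\<^sub>+.
     (- i < - j \<and> - j < - \<sigma> j \<and> - \<sigma> j < - \<sigma> i) \<or>
     (- i < j \<and> j \<le> \<sigma> j \<and> \<sigma> j < - \<sigma> i) \<or>
     (i < j \<and> j \<le> \<sigma> j \<and> \<sigma> j < \<sigma> i)}"

definition A_EN :: "nat \<Rightarrow> (int \<Rightarrow> int) \<Rightarrow> (int \<times> int) set" where
  "A_EN n \<sigma> = {(i, j) \<in> [n]\<^sub>+ \<times> [n]\<^sub>+.
     (- i < 0 \<and> 0 < - \<sigma> i \<and> - \<sigma> i < \<sigma> j \<and> \<sigma> j < j) \<or>
     (i \<le> \<sigma> i \<and> \<sigma> i < \<sigma> j \<and> \<sigma> j < j)}"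

definition A_NE :: "nat \<Rightarrow> (int \<Rightarrow> int) \<Rightarrow> (int \<times> int) set" where
  "A_NE n \<sigma> = {(i, j) \<in> [n]\<^sub>+ \<times> [n]\<^sub>+. \<sigma> i < i \<and> i < j \<and> j \<le> \<sigma> j}"

definition al :: "nat \<Rightarrow> (int \<Rightarrow> int) \<Rightarrow> nat" where
  "al n \<sigma> = card (A_nest n \<sigma>) + card (A_EN n \<sigma>) + card (A_NE n \<sigma>)"

definition crossings :: "nat \<Rightarrow> (int \<Rightarrow> int) \<Rightarrow> (int \<times> int) set" where
  "crossings n \<sigma> = {(i, j) \<in> [n]\<^sub>+ \<times> [n]\<^sub>+.
     (i < j \<and> j \<le> \<sigma> i \<and> \<sigma> i < \<sigma> j) \<or>
     (- i < - j \<and> - j < - \<sigma> i \<and> - \<sigma> i < - \<sigma> j) \<or>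
     (- i < j \<and> j \<le> - \<sigma> i \<and> - \<sigma> i < \<sigma> j)}"

definition cr :: "nat \<Rightarrow> (int \<Rightarrow> int) \<Rightarrow> nat" where
  "cr n \<sigma> = card (crossings n \<sigma>)"

end

theory Submission
  imports Defs
begin

text \<open>
  Write \<open>P\<close> for the weak excedances, \<open>N\<close> for the positions with a negative image and \<open>D\<close> for the
  remaining positions, those with \<open>0 < \<sigma> i < i\<close>, and let \<open>w\<close>, \<open>m\<close>, \<open>d\<close> be their sizes.  As
  \<open>n = w + m + d\<close>, the claimed right-hand side equals \<open>m (m - 1) / 2 + m w + d (w + m - 1)\<close>.

  Sort the pairs \<open>(i, j)\<close> by the classes of \<open>i\<close> and \<open>j\<close>.  Where a block has both nestings
  and crossings, the two conditions differ only by which of two distinct values is larger, so together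
  they no longer compare these values.  In every block the total is a sum of at most two indicators
  that involve positions and the absolute values \<open>v i = \<bar>\<sigma> i\<bar>\<close> only (the \<open>weight\<close> lemmas).  Now
  collect terms.

  The block \<open>N \<times> N\<close> counts the pairs with \<open>j < i\<close> and gives \<open>m (m - 1) / 2\<close>.

  The terms with \<open>j \<in> P\<close> and \<open>i \<in> P \<union> N\<close> are governed by a flow across the level \<open>j\<close>: since \<open>v\<close>
  permutes \<open>[n]\<close>, as many \<open>i\<close> satisfy \<open>i < j\<close> as satisfy \<open>v i < j\<close>.  Hence these terms amount to
  \<open>m\<close> plus the number of \<open>i \<in> D\<close> that jump down over \<open>j\<close>, that is, \<open>v i < j < i\<close>
  (lemma \<open>weak_excedance_column\<close>).

  The terms that remain are attached to an element \<open>k\<close> of \<open>D\<close>.  They count the positions, outside one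
  class each, that lie above \<open>k\<close>, have a value below \<open>v k\<close>, or lie strictly between \<open>v k\<close> and \<open>k\<close>.
  Without the restriction on classes, the sum of these counts is constant: the three intervals
  \<open>{1..<v k}\<close>, \<open>{v k<..<k}\<close>, \<open>{k<..n}\<close> have \<open>n - 2\<close> elements together whatever \<open>k\<close> is.
  The total is \<open>d (w + m - 1)\<close> minus the number of pairs in \<open>P \<times> D\<close> for which the element of \<open>D\<close>
  jumps down over the element of \<open>P\<close> (lemma \<open>drop_total\<close>).
  These are the same pairs as before, so they cancel.
\<close>

section \<open>Counting with indicators\<close>

text \<open>Linear identities between counts are proved summand by summand, so sums of indicators should
  not be turned into cardinalities by simplification.\<close>

declare sum_of_bool_eq [simp del]

lemma card_pairs_eq_sum_of_bool:
  assumes "finite A" and "X \<subseteq> A \<times> A"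
  shows "int (card X) = (\<Sum>i\<in>A. \<Sum>j\<in>A. of_bool ((i, j) \<in> X))"
proof -
  have "(\<Sum>i\<in>A. \<Sum>j\<in>A. of_bool ((i, j) \<in> X) :: int) = (\<Sum>p\<in>A \<times> A. of_bool (p \<in> X))"
    by (simp add: sum.cartesian_product case_prod_unfold)
  also have "\<dots> = int (card ((A \<times> A) \<inter> X))"
    using assms(1) by (simp add: sum_of_bool_eq Int_def)
  finally show ?thesis
    using assms(2) by (simp add: Int_absorb1)
qed

text \<open>For \<open>i \<noteq> j\<close> exactly one of \<open>f i < f j\<close> and \<open>f j < f i\<close> holds.\<close>

lemma twice_sum_of_bool_less:
  fixes f :: "'a \<Rightarrow> int"
  assumes "finite S" and "inj_on f S"
  shows "2 * (\<Sum>j\<in>S. \<Sum>i\<in>S. of_bool (f i < f j)) = int (card S) * (int (card S) - 1)"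
proof -
  have "(\<Sum>j\<in>S. \<Sum>i\<in>S. of_bool (f i < f j) :: int) = (\<Sum>j\<in>S. \<Sum>i\<in>S. of_bool (f j < f i))"
    by (rule sum.swap)
  then have "2 * (\<Sum>j\<in>S. \<Sum>i\<in>S. of_bool (f i < f j) :: int)
      = (\<Sum>j\<in>S. \<Sum>i\<in>S. of_bool (f i < f j) + of_bool (f j < f i))"
    by (simp add: sum.distrib)
  also have "\<dots> = (\<Sum>j\<in>S. \<Sum>i\<in>S. 1 - of_bool (i = j))"
    by (intro sum.cong refl) (auto simp: not_less order_le_less inj_on_eq_iff[OF assms(2)])
  also have "\<dots> = (\<Sum>j\<in>S. int (card S) - 1)"
    using assms(1) by (intro sum.cong refl) (simp add: sum_subtractf of_bool_def)
  finally show ?thesis by simp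
qed

lemma sum_of_bool_interval:
  fixes a b :: int
  assumes "{i\<in>A. Q i} = {a..b}" and "a \<le> b + 1" and "finite A"
  shows "(\<Sum>i\<in>A. of_bool (Q i) :: int) = b + 1 - a"
  using assms by (simp add: sum_of_bool_eq Int_def)

section \<open>Classes of positions\<close>

locale signed_permutation =
  fixes n :: nat and \<sigma> :: "int \<Rightarrow> int"
  assumes signed_perm: "\<sigma> \<in> signed_perms n"
begin

definition P :: "int set" where "P = {i \<in> [n]\<^sub>+. i \<le> \<sigma> i}"
definition N :: "int set" where "N = {i \<in> [n]\<^sub>+. \<sigma> i < 0}"
definition D :: "int set" where "D = {i \<in> [n]\<^sub>+. 0 < \<sigma> i \<and> \<sigma> i < i}"
definition v :: "int \<Rightarrow> int" where "v i = \<bar>\<sigma> i\<bar>"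

lemma permutes: "\<sigma> permutes [\<plusminus>n]"
  and odd: "i \<in> [\<plusminus>n] \<Longrightarrow> \<sigma> (- i) = - \<sigma> i"
  using signed_perm by (auto simp: signed_perms_def)

lemma mem_pos_range: "i \<in> [n]\<^sub>+ \<longleftrightarrow> 1 \<le> i \<and> i \<le> int n"
  by (auto simp: pos_range_def)

lemma mem_pm_range: "i \<in> [\<plusminus>n] \<longleftrightarrow> i \<noteq> 0 \<and> \<bar>i\<bar> \<le> int n"
  by (auto simp: pm_range_def pos_range_def image_iff intro: bexI[of _ "- i"])

lemma finite_pos_range [simp]: "finite [n]\<^sub>+"
  by (simp add: pos_range_def)

lemma finite_classes [simp]: "finite P" "finite N" "finite D"
  by (simp_all add: P_def N_def D_def)

lemma sigma_range: "i \<in> [n]\<^sub>+ \<Longrightarrow> \<sigma> i \<noteq> 0 \<and> \<bar>\<sigma> i\<bar> \<le> int n"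
  using permutes_in_image[OF permutes, of i] by (auto simp: mem_pm_range mem_pos_range)

lemma v_inj:
  assumes "i \<in> [n]\<^sub>+" "j \<in> [n]\<^sub>+" "v i = v j"
  shows "i = j"
proof -
  have "\<sigma> i = \<sigma> j \<or> \<sigma> i = \<sigma> (- j)"
    using assms odd[of j] by (auto simp: v_def mem_pm_range mem_pos_range abs_eq_iff)
  then have "i = j \<or> i = - j"
    using permutes_inj[OF permutes] by (auto dest: injD)
  then show ?thesis using assms by (auto simp: mem_pos_range)
qed

lemma v_bij: "bij_betw v [n]\<^sub>+ [n]\<^sub>+"
proof -
  have "inj_on v [n]\<^sub>+" by (auto intro!: inj_onI v_inj)
  moreover have "v ` [n]\<^sub>+ \<subseteq> [n]\<^sub>+"
    using sigma_range by (fastforce simp: v_def mem_pos_range)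
  ultimately show ?thesis
    by (simp add: bij_betw_def endo_inj_surj)
qed

lemma sum_classes: "(\<Sum>i\<in>[n]\<^sub>+. g i) = (\<Sum>i\<in>P. g i) + (\<Sum>i\<in>D. g i) + (\<Sum>i\<in>N. g i)"
  for g :: "int \<Rightarrow> int"
proof -
  have "[n]\<^sub>+ = P \<union> D \<union> N"
    using sigma_range by (fastforce simp: P_def D_def N_def)
  moreover have "P \<inter> D = {}" "(P \<union> D) \<inter> N = {}"
    by (auto simp: P_def D_def N_def mem_pos_range)
  ultimately show ?thesis by (simp add: sum.union_disjoint)
qed

lemma card_classes: "int n = int (card P) + int (card D) + int (card N)"
  using sum_classes[of "\<lambda>_. 1"] by (simp add: pos_range_def)

lemma sum_v: "(\<Sum>i\<in>[n]\<^sub>+. g (v i)) = (\<Sum>i\<in>[n]\<^sub>+. g i)" for g :: "int \<Rightarrow> int"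
  by (rule sum.reindex_bij_betw[OF v_bij])

section \<open>Reduction to positions and absolute values\<close>

definition weight :: "int \<Rightarrow> int \<Rightarrow> int" where
  "weight i j = of_bool ((i, j) \<in> A_nest n \<sigma>) + of_bool ((i, j) \<in> A_EN n \<sigma>)
     + of_bool ((i, j) \<in> A_NE n \<sigma>) + of_bool ((i, j) \<in> crossings n \<sigma>)"

lemma al_cr_eq_sum_weight:
  "int (al n \<sigma>) + int (cr n \<sigma>) = (\<Sum>i\<in>[n]\<^sub>+. \<Sum>j\<in>[n]\<^sub>+. weight i j)"
proof -
  have "A_nest n \<sigma> \<subseteq> [n]\<^sub>+ \<times> [n]\<^sub>+" "A_EN n \<sigma> \<subseteq> [n]\<^sub>+ \<times> [n]\<^sub>+"
    "A_NE n \<sigma> \<subseteq> [n]\<^sub>+ \<times> [n]\<^sub>+" "crossings n \<sigma> \<subseteq> [n]\<^sub>+ \<times> [n]\<^sub>+"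
    by (auto simp: A_nest_def A_EN_def A_NE_def crossings_def)
  then show ?thesis
    by (simp add: al_def cr_def weight_def sum.distrib
        card_pairs_eq_sum_of_bool[OF finite_pos_range])
qed

lemmas weight_simps =
  weight_def A_nest_def A_EN_def A_NE_def crossings_def P_def N_def D_def v_def mem_pos_range

lemma v_distinct:
  assumes "i \<in> [n]\<^sub>+" "j \<in> [n]\<^sub>+" "i \<noteq> j"
  shows "\<sigma> i \<noteq> \<sigma> j" "\<sigma> i \<noteq> - \<sigma> j"
  using v_inj[OF assms(1,2)] assms(3) by (auto simp: v_def)

lemma weight_PP: "i \<in> P \<Longrightarrow> j \<in> P \<Longrightarrow> weight i j = of_bool (i < j \<and> j \<le> v i)"
  using v_distinct[of i j] by (cases "i = j") (auto simp: weight_simps)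

lemma weight_PD: "i \<in> P \<Longrightarrow> j \<in> D \<Longrightarrow> weight i j = of_bool (v i < v j)"
  by (auto simp: weight_simps)

lemma weight_PN: "i \<in> P \<Longrightarrow> j \<in> N \<Longrightarrow> weight i j = 0"
  by (auto simp: weight_simps)

lemma weight_DP: "i \<in> D \<Longrightarrow> j \<in> P \<Longrightarrow> weight i j = of_bool (i < j)"
  by (auto simp: weight_simps)

lemma weight_DD: "i \<in> D \<Longrightarrow> j \<in> D \<Longrightarrow> weight i j = of_bool (v i < j \<and> j < i)"
  using v_distinct[of i j] by (cases "i = j") (auto simp: weight_simps)

lemma weight_DN: "i \<in> D \<Longrightarrow> j \<in> N \<Longrightarrow> weight i j = of_bool (v i < j \<and> j < i)"
  by (auto simp: weight_simps)

text \<open>The two indicators can both be \<open>1\<close>: \<open>j \<le> v i\<close> joins the nestings \<open>\<sigma> j < v i\<close> and the crossings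
  \<open>j \<le> v i < \<sigma> j\<close>, whereas \<open>i < j\<close> is the condition of \<^const>\<open>A_NE\<close>, which may hold besides either.\<close>

lemma weight_NP: "i \<in> N \<Longrightarrow> j \<in> P \<Longrightarrow> weight i j = of_bool (j \<le> v i) + of_bool (i < j)"
  using v_distinct[of i j] by (cases "i = j") (auto simp: weight_simps)

lemma weight_ND: "i \<in> N \<Longrightarrow> j \<in> D \<Longrightarrow> weight i j = of_bool (v i < v j) + of_bool (j < i)"
  by (auto simp: weight_simps)

lemma weight_NN: "i \<in> N \<Longrightarrow> j \<in> N \<Longrightarrow> weight i j = of_bool (j < i)"
  using v_distinct[of i j] by (cases "i = j") (auto simp: weight_simps)

section \<open>Evaluation of the reduced count\<close>

text \<open>An element of \<open>P\<close> crosses the level \<open>j\<close> upwards and an element of \<open>D\<close> crosses it downwards.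
  The net flow over \<open>P \<union> D\<close> is the opposite of the net flow over \<open>N\<close>, because \<open>v\<close> is a permutation;
  the two sums over \<open>N\<close> on the left turn that into the constant.\<close>

lemma weak_excedance_column:
  assumes "j \<in> P"
  shows "(\<Sum>i\<in>P. of_bool (i < j \<and> j \<le> v i)) + (\<Sum>i\<in>N. of_bool (j \<le> v i)) + (\<Sum>i\<in>N. of_bool (i < j))
    = int (card N) + (\<Sum>i\<in>D. of_bool (v i < j \<and> j < i))"
proof -
  have up: "(\<Sum>i\<in>P. of_bool (i < j \<and> j \<le> v i) :: int)
      = (\<Sum>i\<in>P. of_bool (i < j)) - (\<Sum>i\<in>P. of_bool (v i < j))"
    unfolding sum_subtractf[symmetric]
    by (intro sum.cong refl) (auto simp: P_def v_def mem_pos_range)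
  have down: "(\<Sum>i\<in>D. of_bool (v i < j \<and> j < i) :: int)
      = (\<Sum>i\<in>D. of_bool (v i < j)) - (\<Sum>i\<in>D. of_bool (i < j))"
    \<comment> \<open>the position \<open>i = j\<close>, where the two sides would differ, does not occur as \<open>j \<notin> D\<close>\<close>
    unfolding sum_subtractf[symmetric] using assms
    by (intro sum.cong refl) (auto simp: P_def D_def v_def mem_pos_range)
  have "(\<Sum>i\<in>N. of_bool (j \<le> v i)) + (\<Sum>i\<in>N. of_bool (v i < j)) = (\<Sum>i\<in>N. (1::int))"
    unfolding sum.distrib[symmetric] by (intro sum.cong refl) auto
  moreover have "(\<Sum>i\<in>[n]\<^sub>+. of_bool (v i < j) :: int) = (\<Sum>i\<in>[n]\<^sub>+. of_bool (i < j))"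
    by (rule sum_v)
  ultimately show ?thesis
    using up down by (simp add: sum_classes)
qed

text \<open>The column of \<open>k \<in> D\<close> consists of three counts, each completed to a count over all of \<open>[n]\<close> by the
  missing class: \<open>D\<close> for the positions above \<open>k\<close> and for the values below \<open>v k\<close>, \<open>P\<close> for the positions
  between \<open>v k\<close> and \<open>k\<close>.  The completed counts are \<open>n - k\<close>, \<open>v k - 1\<close> and \<open>k - v k - 1\<close>.\<close>

lemma drop_column:
  assumes "k \<in> D"
  shows "(\<Sum>i\<in>P. of_bool (k < i)) + (\<Sum>i\<in>N. of_bool (k < i))
      + (\<Sum>i\<in>P. of_bool (v i < v k)) + (\<Sum>i\<in>N. of_bool (v i < v k))
      + (\<Sum>i\<in>D. of_bool (v k < i \<and> i < k)) + (\<Sum>i\<in>N. of_bool (v k < i \<and> i < k))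
    = int n - 2 - (\<Sum>i\<in>D. of_bool (k < i)) - (\<Sum>i\<in>D. of_bool (v i < v k))
      - (\<Sum>i\<in>P. of_bool (v k < i \<and> i < k))"
proof -
  have k: "1 \<le> v k" "v k < k" "k \<le> int n"
    using assms by (auto simp: D_def v_def mem_pos_range)
  have "(\<Sum>i\<in>[n]\<^sub>+. of_bool (k < i)) = int n + 1 - (k + 1)"
    by (rule sum_of_bool_interval) (use k in \<open>auto simp: mem_pos_range\<close>)
  moreover have "(\<Sum>i\<in>[n]\<^sub>+. of_bool (v i < v k) :: int) = (\<Sum>i\<in>[n]\<^sub>+. of_bool (i < v k))"
    by (rule sum_v)
  moreover have "(\<Sum>i\<in>[n]\<^sub>+. of_bool (i < v k)) = (v k - 1) + 1 - 1"
    by (rule sum_of_bool_interval) (use k in \<open>auto simp: mem_pos_range\<close>)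
  moreover have "(\<Sum>i\<in>[n]\<^sub>+. of_bool (v k < i \<and> i < k)) = (k - 1) + 1 - (v k + 1)"
    by (rule sum_of_bool_interval) (use k in \<open>auto simp: mem_pos_range\<close>)
  ultimately show ?thesis
    by (simp add: sum_classes)
qed

text \<open>Over all \<open>k \<in> D\<close>, each of the two subtracted counts inside \<open>D\<close> runs over half of the ordered
  pairs of distinct elements, and \<open>n - 2 - (d - 1) = w + m - 1\<close>.\<close>

lemma drop_total:
  "(\<Sum>k\<in>D. (\<Sum>i\<in>P. of_bool (k < i)) + (\<Sum>i\<in>N. of_bool (k < i))
      + (\<Sum>i\<in>P. of_bool (v i < v k)) + (\<Sum>i\<in>N. of_bool (v i < v k))
      + (\<Sum>i\<in>D. of_bool (v k < i \<and> i < k)) + (\<Sum>i\<in>N. of_bool (v k < i \<and> i < k)))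
    = int (card D) * (int (card P) + int (card N) - 1)
      - (\<Sum>k\<in>D. \<Sum>i\<in>P. of_bool (v k < i \<and> i < k))" (is "?L = _ - ?X")
proof -
  have "?L = int (card D) * (int n - 2) - (\<Sum>k\<in>D. \<Sum>i\<in>D. of_bool (k < i))
      - (\<Sum>k\<in>D. \<Sum>i\<in>D. of_bool (v i < v k)) - ?X"
    by (simp add: drop_column sum_subtractf)
  moreover have "2 * (\<Sum>k\<in>D. \<Sum>i\<in>D. of_bool (k < i)) = int (card D) * (int (card D) - 1)"
    using twice_sum_of_bool_less[of D uminus] by simp
  moreover have "inj_on v D"
    using v_bij by (auto simp: D_def bij_betw_def intro: inj_on_subset)
  then have "2 * (\<Sum>k\<in>D. \<Sum>i\<in>D. of_bool (v i < v k)) = int (card D) * (int (card D) - 1)"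
    by (intro twice_sum_of_bool_less) simp_all
  ultimately have "?L = int (card D) * (int n - 2) - int (card D) * (int (card D) - 1) - ?X"
    by linarith
  then show ?thesis
    by (simp add: card_classes algebra_simps)
qed

text \<open>The blocks \<open>P \<times> P\<close> and \<open>N \<times> P\<close> are summed by their second entry.  The blocks with an entry in
  \<open>D\<close> are summed by that entry, where a pair in \<open>D \<times> D\<close> is attached to the first one, the element that
  jumps over the other.\<close>

lemma twice_al_cr:
  "2 * (int (al n \<sigma>) + int (cr n \<sigma>)) = int (card N) * (int (card N) - 1)
    + 2 * (int (card N) * int (card P)) + 2 * (int (card D) * (int (card P) + int (card N) - 1))"
proof -
  have "int (al n \<sigma>) + int (cr n \<sigma>) = (\<Sum>i\<in>N. \<Sum>j\<in>N. of_bool (j < i))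
    + ((\<Sum>i\<in>P. \<Sum>j\<in>P. of_bool (i < j \<and> j \<le> v i)) + (\<Sum>i\<in>N. \<Sum>j\<in>P. of_bool (j \<le> v i))
        + (\<Sum>i\<in>N. \<Sum>j\<in>P. of_bool (i < j)))
    + ((\<Sum>i\<in>D. \<Sum>j\<in>P. of_bool (i < j)) + (\<Sum>i\<in>N. \<Sum>j\<in>D. of_bool (j < i))
        + (\<Sum>i\<in>P. \<Sum>j\<in>D. of_bool (v i < v j)) + (\<Sum>i\<in>N. \<Sum>j\<in>D. of_bool (v i < v j))
        + (\<Sum>i\<in>D. \<Sum>j\<in>D. of_bool (v i < j \<and> j < i)) + (\<Sum>i\<in>D. \<Sum>j\<in>N. of_bool (v i < j \<and> j < i)))"
    by (simp add: al_cr_eq_sum_weight sum_classes sum.distrib weight_PP weight_PD weight_PN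
        weight_DP weight_DD weight_DN weight_NP weight_ND weight_NN)
  also have "(\<Sum>i\<in>P. \<Sum>j\<in>P. of_bool (i < j \<and> j \<le> v i)) + (\<Sum>i\<in>N. \<Sum>j\<in>P. of_bool (j \<le> v i))
        + (\<Sum>i\<in>N. \<Sum>j\<in>P. of_bool (i < j))
      = (\<Sum>j\<in>P. (\<Sum>i\<in>P. of_bool (i < j \<and> j \<le> v i)) + (\<Sum>i\<in>N. of_bool (j \<le> v i))
          + (\<Sum>i\<in>N. of_bool (i < j) :: int))"
    by (simp add: sum.distrib sum.swap[of _ P N]
        sum.swap[of "\<lambda>i j. of_bool (i < j \<and> j \<le> v i)" P P])
  also have "\<dots> = int (card N) * int (card P) + (\<Sum>j\<in>P. \<Sum>i\<in>D. of_bool (v i < j \<and> j < i))"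
    by (simp add: weak_excedance_column sum.distrib)
  also have "(\<Sum>i\<in>D. \<Sum>j\<in>P. of_bool (i < j)) + (\<Sum>i\<in>N. \<Sum>j\<in>D. of_bool (j < i))
        + (\<Sum>i\<in>P. \<Sum>j\<in>D. of_bool (v i < v j)) + (\<Sum>i\<in>N. \<Sum>j\<in>D. of_bool (v i < v j))
        + (\<Sum>i\<in>D. \<Sum>j\<in>D. of_bool (v i < j \<and> j < i)) + (\<Sum>i\<in>D. \<Sum>j\<in>N. of_bool (v i < j \<and> j < i))
      = int (card D) * (int (card P) + int (card N) - 1)
        - (\<Sum>k\<in>D. \<Sum>i\<in>P. of_bool (v k < i \<and> i < k))"
    unfolding drop_total[symmetric]
    by (simp add: sum.distrib sum.swap[of _ D N] sum.swap[of _ D P])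
  also have "(\<Sum>k\<in>D. \<Sum>i\<in>P. of_bool (v k < i \<and> i < k) :: int)
      = (\<Sum>i\<in>P. \<Sum>k\<in>D. of_bool (v k < i \<and> i < k))"
    by (rule sum.swap)
  finally have "int (al n \<sigma>) + int (cr n \<sigma>) = (\<Sum>i\<in>N. \<Sum>j\<in>N. of_bool (j < i))
      + int (card N) * int (card P) + int (card D) * (int (card P) + int (card N) - 1)"
    by simp
  moreover have "2 * (\<Sum>i\<in>N. \<Sum>j\<in>N. of_bool (j < i)) = int (card N) * (int (card N) - 1)"
    using twice_sum_of_bool_less[of N id] by simp
  ultimately show ?thesis by simp
qed

end

section \<open>The count of alignments and crossings\<close>

theorem theorem3p3:
  fixes n :: nat and \<sigma> :: "int \<Rightarrow> int"
  assumes "n \<ge> 1" and "\<sigma> \<in> signed_perms n"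
  shows "real (al n \<sigma>) + real (cr n \<sigma>) =
    (real n - 1 / 2 * real (fwex n \<sigma>)) * (real (wex n \<sigma>) - 1 + real (neg n \<sigma>))
      + 1 / 2 * real (neg n \<sigma>) * real (wex n \<sigma>)"
proof -
  interpret signed_permutation n \<sigma>
    by unfold_locales (rule assms(2))
  have wex: "wex n \<sigma> = card P" and neg: "neg n \<sigma> = card N"
    by (simp_all add: wex_def neg_def P_def N_def)
  have n: "real n = real (card P) + real (card D) + real (card N)"
    using arg_cong[OF card_classes, of real_of_int] by simp
  have "2 * (real (al n \<sigma>) + real (cr n \<sigma>)) = real (card N) * (real (card N) - 1)
    + 2 * (real (card N) * real (card P))
    + 2 * (real (card D) * (real (card P) + real (card N) - 1))"
    using arg_cong[OF twice_al_cr, of real_of_int] by simp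
  then show ?thesis
    unfolding fwex_def wex neg n by (simp add: field_simps)
qed

end
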